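(* Let $k\ge 1$ and $n\ge 2k+1$ be integers. Let $t=\lfloor \log_2 k\rfloor+1$, let $q=\lfloor n/2^t\rfloor$ and $r=n-2^t q$ (the quotient and remainder of dividing $n$ by $2^t$), let $\lambda=s(k,k+1+2^t,2^t)$ and $\mu=w(k,r+2^t)$. Then $$w(k,n)=(q-1)\lambda+\mu.$$
   Context: Work over the field $\mathbb{F}_2$ of order $2$. For $\mathbf{x}=(x_0,\ldots,x_{n-1})\in\mathbb{F}_2^n$, its derivative is $\partial\mathbf{x}=(x_0+x_1,x_1+x_2,\ldots,x_{n-2}+x_{n-1})\in\mathbb{F}_2^{n-1}$; set $\partial^0\mathbf{x}=\mathbf{x}$ and $\partial^{j}\mathbf{x}=\partial(\partial^{j-1}\mathbf{x})$ for $j\ge1$. The Steinhaus triangle generated by $\mathbf{x}$ is $T(\mathbf{x})=(\mathbf{x},\partial\mathbf{x},\ldots,\partial^{n-1}\mathbf{x})$; its row $j$ (rows numbered $0,\ldots,n-1$) is $\partial^j\mathbf{x}$. The weight $|\mathbf{y}|$ of a binary sequence is its number of entries equal to $1$, and the weight of the triangle is $|T(\mathbf{x})|=\sum_{j=0}^{n-1}|\partial^j\mathbf{x}|$. For $n\ge1$ and $0\le k\le n-1$, let $\mathbf{e}_k^{(n)}\in\mathbb{F}_2^n$ be the sequence with a $1$ in position $k$ (positions numbered $0,\ldots,n-1$) and $0$ elsewhere. Define $T(k,n)=T(\mathbf{e}_k^{(n)})$ and $w(k,n)=|T(k,n)|$. For $1\le m\le n$, let $s(k,n,m)=\sum_{j=0}^{m-1}|\partial^j\mathbf{e}_k^{(n)}|$,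 the sum of the weights of rows $0,1,\ldots,m-1$ of $T(k,n)$. *)

theory Defs
  imports Complex_Main "HOL-Library.Z2"
begin

text \<open>The field of order 2 is the type \<^typ>\<open>bit\<close>; a sequence in its \<open>n\<close>-th power is a list
  of length \<open>n\<close>.\<close>

definition seq_deriv :: "bit list \<Rightarrow> bit list" where
  "seq_deriv x = map (\<lambda>i. x ! i + x ! (i + 1)) [0..<length x - 1]"

definition steinhaus_triangle :: "bit list \<Rightarrow> bit list list" where
  "steinhaus_triangle x = map (\<lambda>j. (seq_deriv ^^ j) x) [0..<length x]"

definition seq_weight :: "bit list \<Rightarrow> nat" where
  "seq_weight y = card {i. i < length y \<and> y ! i = 1}"

definition triangle_weight :: "bit list list \<Rightarrow> nat" where
  "triangle_weight T = (\<Sum>j<length T. seq_weight (T ! j))"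

definition unit_seq :: "nat \<Rightarrow> nat \<Rightarrow> bit list" where
  "unit_seq k n = map (\<lambda>i. if i = k then 1 else 0) [0..<n]"

definition T :: "nat \<Rightarrow> nat \<Rightarrow> bit list list" where
  "T k n = steinhaus_triangle (unit_seq k n)"

definition w :: "nat \<Rightarrow> nat \<Rightarrow> nat" where
  "w k n = triangle_weight (T k n)"

definition s :: "nat \<Rightarrow> nat \<Rightarrow> nat \<Rightarrow> nat" where
  "s k n m = (\<Sum>j<m. seq_weight ((seq_deriv ^^ j) (unit_seq k n)))"

end

theory Submission
  imports Defs
begin

text \<open>Extend the derivative to infinite sequences. In characteristic 2 the \<open>2\<^sup>t\<close>-fold derivative of \<open>x\<close> at \<open>i\<close> is
  \<open>x i + x (i + N)\<close> with \<open>N = 2\<^sup>t\<close>, so it fixes the unit sequence \<open>e\<^sub>k\<close> as soon as \<open>k < N\<close>. Hence row \<open>N + j\<close>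
  of \<open>T(k, m + N)\<close> is row \<open>j\<close> of \<open>T(k, m)\<close>. All ones of the triangle lie in columns \<open>0, \<dots>, k\<close>, so for \<open>m > k\<close>
  truncation does not affect the first \<open>N\<close> rows, whose total weight is therefore \<open>\<lambda>\<close>. Thus
  \<open>w(k, m + N) = \<lambda> + w(k, m)\<close>, and one iterates.\<close>

definition delta :: "(nat \<Rightarrow> bit) \<Rightarrow> nat \<Rightarrow> bit" where
  "delta x i = x i + x (Suc i)"

definition unit_fun :: "nat \<Rightarrow> nat \<Rightarrow> bit" where
  "unit_fun k i = (if i = k then 1 else 0)"

lemma seq_deriv_map_upt: "seq_deriv (map x [0..<n]) = map (delta x) [0..<n - 1]"
  by (auto simp: seq_deriv_def delta_def)

lemma seq_deriv_funpow_map_upt: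
  "(seq_deriv ^^ j) (map x [0..<n]) = map ((delta ^^ j) x) [0..<n - j]"
  by (induction j) (simp_all add: seq_deriv_map_upt)

lemma seq_weight_map_upt: "seq_weight (map x [0..<n]) = card {i. i < n \<and> x i = 1}"
  unfolding seq_weight_def by (rule arg_cong[where f = card]) auto

lemma seq_weight_row:
  "seq_weight ((seq_deriv ^^ j) (unit_seq k n)) =
     card {i. i < n - j \<and> (delta ^^ j) (unit_fun k) i = 1}"
proof -
  have "unit_seq k n = map (unit_fun k) [0..<n]"
    by (simp add: unit_seq_def unit_fun_def)
  then show ?thesis
    by (simp only: seq_deriv_funpow_map_upt seq_weight_map_upt)
qed

lemma w_eq_s: "w k n = s k n n"
  by (simp add: w_def triangle_weight_def T_def steinhaus_triangle_def s_def unit_seq_def)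

text \<open>With S the left shift, \<open>delta\<close> is 1 + S, and squaring repeatedly gives (1 +
  S)^(2^t) = 1 + S^(2^t) in characteristic 2.\<close>

lemma delta_funpow_two_power: "(delta ^^ (2 ^ t)) x i = x i + x (i + 2 ^ t)"
proof (induction t arbitrary: x i)
  case 0
  show ?case by (simp add: delta_def)
next
  case (Suc t)
  have "(delta ^^ (2 ^ Suc t)) x i = (delta ^^ (2 ^ t)) ((delta ^^ (2 ^ t)) x) i"
    by (simp add: mult_2 funpow_add)
  also have "\<dots> = (x i + x (i + 2 ^ t)) + (x (i + 2 ^ t) + x (i + 2 ^ t + 2 ^ t))"
    by (simp only: Suc.IH)
  also have "\<dots> = x i + x (i + 2 ^ Suc t)"
    \<comment> \<open>The middle term occurs twice and cancels.\<close>
    by (cases "x i"; cases "x (i + 2 ^ t)"; cases "x (i + 2 ^ t + 2 ^ t)") (simp_all add: mult_2 add.assoc)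
  finally show ?case .
qed

lemma delta_funpow_unit_fun:
  assumes "k < 2 ^ t"
  shows "(delta ^^ (2 ^ t)) (unit_fun k) = unit_fun k"
  using assms by (auto simp: delta_funpow_two_power unit_fun_def)

text \<open>\<open>delta\<close> at i reads only positions i and i + 1, so ones never spread to the
  right.\<close>

lemma delta_funpow_unit_fun_eq_0: "k < i \<Longrightarrow> (delta ^^ j) (unit_fun k) i = 0"
  by (induction j arbitrary: i) (simp_all add: delta_def unit_fun_def)

text \<open>The right-hand side is free of \<open>n\<close>, which makes rows of triangles of
  different sizes comparable.\<close>

lemma seq_weight_row_untruncated:
  assumes "k < n - j"
  shows "seq_weight ((seq_deriv ^^ j) (unit_seq k n)) =
    card {i. (delta ^^ j) (unit_fun k) i = 1}"
proof -
  have "i < n - j" if "(delta ^^ j) (unit_fun k) i = 1" for i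
    using that assms delta_funpow_unit_fun_eq_0[of k i j] by (cases "k < i") auto
  then show ?thesis
    unfolding seq_weight_row by (intro arg_cong[where f = card]) auto
qed

lemma sum_lessThan_add:
  fixes f :: "nat \<Rightarrow> 'a :: comm_monoid_add"
  shows "(\<Sum>j<a + b. f j) = (\<Sum>j<a. f j) + (\<Sum>j<b. f (a + j))"
  by (induction b) (simp_all add: add.assoc)

lemma w_add_two_power:
  assumes "k < 2 ^ t" and "k < m"
  shows "w k (m + 2 ^ t) = s k (k + 1 + 2 ^ t) (2 ^ t) + w k m"
proof -
  let ?N = "2 ^ t :: nat"
  let ?row = "\<lambda>n j. seq_weight ((seq_deriv ^^ j) (unit_seq k n))"
  \<comment> \<open>For \<open>j < ?N\<close> both rows have length greater than
    \<open>k\<close>.\<close>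
  have top: "?row (m + ?N) j = ?row (k + 1 + ?N) j" if "j < ?N" for j
    using that assms(2) by (simp only: seq_weight_row_untruncated)
  have bottom: "?row (m + ?N) (?N + j) = ?row m j" for j
  proof -
    have "(delta ^^ (?N + j)) (unit_fun k) = (delta ^^ j) (unit_fun k)"
      using delta_funpow_unit_fun[OF assms(1)] by (simp add: add.commute[of ?N] funpow_add)
    then show ?thesis
      \<comment> \<open>The truncation lengths agree too: (m + N) - (N + j) = m - j.\<close>
      by (simp only: seq_weight_row) simp
  qed
  have "w k (m + ?N) = (\<Sum>j<?N + m. ?row (m + ?N) j)"
    by (simp add: w_eq_s s_def add.commute)
  also have "\<dots> = (\<Sum>j<?N. ?row (m + ?N) j) + (\<Sum>j<m. ?row (m + ?N) (?N + j))"
    by (rule sum_lessThan_add)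
  also have "\<dots> = s k (k + 1 + ?N) ?N + w k m"
    by (simp add: w_eq_s s_def top bottom)
  finally show ?thesis .
qed

lemma w_add_mult_two_power:
  assumes "k < 2 ^ t" and "k < m"
  shows "w k (m + c * 2 ^ t) = c * s k (k + 1 + 2 ^ t) (2 ^ t) + w k m"
proof (induction c)
  case (Suc c)
  have "w k (m + Suc c * 2 ^ t) = w k ((m + c * 2 ^ t) + 2 ^ t)"
    by (simp add: algebra_simps)
  also have "\<dots> = s k (k + 1 + 2 ^ t) (2 ^ t) + w k (m + c * 2 ^ t)"
    using assms by (intro w_add_two_power) auto
  finally show ?case
    using Suc by simp
qed simp

lemma two_power_floor_log_bounds:
  assumes "k \<ge> 1"
  shows "k < 2 ^ (nat \<lfloor>log 2 (real k)\<rfloor> + 1)" and "2 ^ nat \<lfloor>log 2 (real k)\<rfloor> \<le> k"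
proof -
  define l where "l = nat \<lfloor>log 2 (real k)\<rfloor>"
  \<comment> \<open>Nonnegativity ensures that \<open>nat\<close> does not alter the floor.\<close>
  have "log 2 (real k) \<ge> 0"
    using assms by simp
  then have "\<lfloor>log 2 (real k)\<rfloor> = int l"
    by (simp add: l_def)
  then have "2 ^ l \<le> k \<and> k < 2 ^ (l + 1)"
    using floor_log_nat_eq_powr_iff[of 2 k l] assms by simp
  then show "k < 2 ^ (nat \<lfloor>log 2 (real k)\<rfloor> + 1)" "2 ^ nat \<lfloor>log 2 (real k)\<rfloor> \<le> k"
    by (simp_all add: l_def)
qed

theorem theorem2:
  fixes k n t q r lam mu :: nat
  assumes "k \<ge> 1" and "n \<ge> 2 * k + 1"
    and "t = nat \<lfloor>log 2 (real k)\<rfloor> + 1"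
    and "q = n div 2 ^ t"
    and "r = n - 2 ^ t * q"
    and "lam = s k (k + 1 + 2 ^ t) (2 ^ t)"
    and "mu = w k (r + 2 ^ t)"
  shows "int (w k n) = (int q - 1) * int lam + int mu"
proof -
  have k_less: "k < 2 ^ t"
    using two_power_floor_log_bounds(1)[OF assms(1)] assms(3) by simp
  \<comment> \<open>Here 2^t is twice 2^(t-1), hence at most 2k < n.\<close>
  have "2 ^ t \<le> n"
    using two_power_floor_log_bounds(2)[OF assms(1)] assms(2,3) by simp
  then have "q \<ge> 1"
    using assms(4) by (simp add: Suc_le_eq div_greater_zero_iff)
  then obtain c where c: "q = Suc c"
    by (cases q) auto
  have "n = r + 2 ^ t * q"
    using assms(4,5) by simp
  \<comment> \<open>Only q - 1 blocks are peeled off: \<open>r\<close> alone may be at most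
    \<open>k\<close>, whereas \<open>r + 2 ^ t\<close> exceeds \<open>k\<close>, as the recursion
    requires.\<close>
  then have "n = (r + 2 ^ t) + c * 2 ^ t"
    by (simp add: c algebra_simps)
  then have "w k n = c * lam + mu"
    using w_add_mult_two_power[OF k_less, of "r + 2 ^ t" c] k_less assms(6,7) by simp
  then show ?thesis
    by (simp add: c)
qed

end
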